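(* Let $x\in\mathbb{Z}_2$, $k\in\mathbb{N}$ and $a\in\mathbb{N}$ with $a<2^k$, and let $m=\alpha(a)$. Then $$\Phi\left(a+2^kx\right)=\Phi(a)+\frac{\Phi(x)}{3^m}2^k.$$
   Context: $\mathbb{Z}_2$ is the ring of $2$-adic integers; $\mathbb{N}=\{0,1,2,\dots\}$. The map $\Phi:\mathbb{Z}_2\to\mathbb{Z}_2$ is defined as follows: if $x=\sum_i 2^{e_i}$ with $0\leq e_0<e_1<\cdots$ (finite or infinite sum; $x=0$ is the empty sum), then $\Phi(x)=-\sum_i 2^{e_i}3^{-i}$ ($\Phi(0)=0$). For $a\in\mathbb{N}$ with binary expansion $a=\sum_i d_i2^i$, $d_i\in\{0,1\}$, $\alpha(a)=\sum_i d_i$ is the number of ones in its binary expansion. *)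

theory Defs
  imports "HOL-Analysis.Analysis" "HOL-Computational_Algebra.Primes"
begin

section \<open>The ring of 2-adic integers\<close>

text \<open>The inverse limit of the rings of integers modulo \<open>2 ^ n\<close>, each residue class being
  represented by its least nonnegative element (the case \<open>m = n\<close> of the condition).\<close>

typedef two_adic_int = "{f :: nat \<Rightarrow> int. \<forall>m n. m \<le> n \<longrightarrow> f n mod 2 ^ m = f m}"
  morphisms residue Abs_two_adic_int
  by (rule exI[of _ "\<lambda>_. 0"]) simp

setup_lifting type_definition_two_adic_int

lemma mod_mod_two_power: "m \<le> n \<Longrightarrow> (a mod 2 ^ n) mod 2 ^ m = a mod (2 ^ m :: int)"
  by (simp add: mod_mod_cancel le_imp_power_dvd)

lemma residue_mod: "m \<le> n \<Longrightarrow> residue x n mod 2 ^ m = residue x m"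
  using residue[of x] by simp

lemma residue_mod_self [simp]: "residue x n mod 2 ^ n = residue x n"
  by (simp add: residue_mod)

lemma residue_zero_index [simp]: "residue x 0 = 0"
  using residue_mod_self[of x 0] by simp

lemma residue_nonneg: "0 \<le> residue x n" and residue_less: "residue x n < 2 ^ n"
  using pos_mod_sign[of "2 ^ n" "residue x n"] pos_mod_bound[of "2 ^ n" "residue x n"] by simp_all

lemma two_adic_int_eqI: "(\<And>n. residue x n = residue y n) \<Longrightarrow> x = y"
  by (simp add: residue_inject[symmetric] fun_eq_iff)

lemma residue_eq_mono: "residue x n = residue y n \<Longrightarrow> m \<le> n \<Longrightarrow> residue x m = residue y m"
  by (metis residue_mod)

instantiation two_adic_int :: comm_ring_1
begin

lift_definition zero_two_adic_int :: two_adic_int is "\<lambda>_. 0" by simp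

lift_definition one_two_adic_int :: two_adic_int is "\<lambda>n. 1 mod 2 ^ n"
  by (simp add: mod_mod_two_power)

lift_definition plus_two_adic_int :: "two_adic_int \<Rightarrow> two_adic_int \<Rightarrow> two_adic_int"
  is "\<lambda>f g n. (f n + g n) mod 2 ^ n"
  by (simp add: mod_mod_two_power) (metis mod_add_eq)

lift_definition minus_two_adic_int :: "two_adic_int \<Rightarrow> two_adic_int \<Rightarrow> two_adic_int"
  is "\<lambda>f g n. (f n - g n) mod 2 ^ n"
  by (simp add: mod_mod_two_power) (metis mod_diff_eq)

lift_definition uminus_two_adic_int :: "two_adic_int \<Rightarrow> two_adic_int"
  is "\<lambda>f n. (- f n) mod 2 ^ n"
  by (simp add: mod_mod_two_power) (metis mod_minus_eq)

lift_definition times_two_adic_int :: "two_adic_int \<Rightarrow> two_adic_int \<Rightarrow> two_adic_int"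
  is "\<lambda>f g n. (f n * g n) mod 2 ^ n"
  by (simp add: mod_mod_two_power) (metis mod_mult_eq)

lemmas residue_simps =
  zero_two_adic_int.rep_eq one_two_adic_int.rep_eq plus_two_adic_int.rep_eq
  minus_two_adic_int.rep_eq uminus_two_adic_int.rep_eq times_two_adic_int.rep_eq

instance
proof
  fix a b c :: two_adic_int
  show "a * b * c = a * (b * c)"
    by (rule two_adic_int_eqI) (simp add: residue_simps mod_simps mult.assoc)
  show "a * b = b * a"
    by (rule two_adic_int_eqI) (simp add: residue_simps mult.commute)
  show "1 * a = a"
    by (rule two_adic_int_eqI) (simp add: residue_simps mod_simps)
  show "(a + b) * c = a * c + b * c"
    by (rule two_adic_int_eqI) (simp add: residue_simps mod_simps distrib_right)
  show "a + b + c = a + (b + c)"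
    by (rule two_adic_int_eqI) (simp add: residue_simps mod_simps add.assoc)
  show "a + b = b + a"
    by (rule two_adic_int_eqI) (simp add: residue_simps add.commute)
  show "0 + a = a"
    by (rule two_adic_int_eqI) (simp add: residue_simps)
  show "- a + a = 0"
    by (rule two_adic_int_eqI) (simp add: residue_simps mod_simps)
  show "a - b = a + - b"
    by (rule two_adic_int_eqI) (simp add: residue_simps mod_simps)
  have "residue 0 1 \<noteq> residue 1 1"
    by (simp add: residue_simps)
  thus "(0 :: two_adic_int) \<noteq> 1" by metis
qed

end

lemma residue_of_nat: "residue (of_nat a) n = int a mod 2 ^ n"
  by (induction a) (simp_all add: residue_simps mod_simps)

lemma residue_of_int: "residue (of_int a) n = a mod 2 ^ n"
  by (cases a) (simp_all add: residue_simps residue_of_nat mod_simps del: of_nat_Suc)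

lemma residue_power: "residue (x ^ k) n = residue x n ^ k mod 2 ^ n"
  by (induction k) (simp_all add: residue_simps mod_simps)

lemma residue_sum: "residue (sum f A) n = (\<Sum>i\<in>A. residue (f i) n) mod 2 ^ n"
  by (induction A rule: infinite_finite_induct) (simp_all add: residue_simps mod_simps)

lemma residue_numeral: "residue (numeral w) n = numeral w mod 2 ^ n"
  using residue_of_int[of "numeral w" n] by simp

lemma residue_two_power: "residue (2 ^ k) n = 2 ^ k mod 2 ^ n"
  using residue_of_int[of "2 ^ k" n] by simp

lemma not_two_power_dvd_mult:
  fixes a b :: int
  assumes "\<not> 2 ^ m dvd a" "\<not> 2 ^ n dvd b"
  shows "\<not> 2 ^ (m + n) dvd a * b"
proof -
  have nz: "a \<noteq> 0" "b \<noteq> 0" using assms by auto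
  have p: "prime_elem (2 :: int)" by simp
  have "multiplicity 2 a < m" "multiplicity 2 b < n"
    using assms by (meson multiplicity_dvd' not_less)+
  hence "multiplicity 2 (a * b) < m + n"
    using prime_elem_multiplicity_mult_distrib[OF p nz] by linarith
  thus ?thesis
    using nz by (simp add: power_dvd_iff_le_multiplicity)
qed

text \<open>Division is the exact quotient, when it exists; thus \<open>x / 3 ^ i\<close> is the product
  of \<open>x\<close> and the inverse of the unit \<open>3 ^ i\<close>.\<close>

instantiation two_adic_int :: inverse
begin

definition divide_two_adic_int :: "two_adic_int \<Rightarrow> two_adic_int \<Rightarrow> two_adic_int" where
  "divide_two_adic_int x y = (if y \<noteq> 0 \<and> y dvd x then THE z. x = y * z else 0)"

definition inverse_two_adic_int :: "two_adic_int \<Rightarrow> two_adic_int" where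
  "inverse_two_adic_int x = 1 div x"

instance ..

end

instance two_adic_int :: idom_divide
proof
  have no_zero_div: "x * y \<noteq> 0" if nz: "x \<noteq> 0" "y \<noteq> 0" for x y :: two_adic_int
  proof
    assume eq: "x * y = 0"
    obtain m n where mn: "residue x m \<noteq> 0" "residue y n \<noteq> 0"
      using nz two_adic_int_eqI[of x 0] two_adic_int_eqI[of y 0]
      by (auto simp: zero_two_adic_int.rep_eq)
    have "\<not> 2 ^ m dvd residue x (m + n)" "\<not> 2 ^ n dvd residue y (m + n)"
      using mn by (simp_all add: dvd_eq_mod_eq_0 residue_mod)
    from not_two_power_dvd_mult[OF this] have "residue (x * y) (m + n) \<noteq> 0"
      by (simp add: residue_simps dvd_eq_mod_eq_0)
    thus False
      by (simp add: eq zero_two_adic_int.rep_eq)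
  qed
  fix a b :: two_adic_int
  show "a \<noteq> 0 \<Longrightarrow> b \<noteq> 0 \<Longrightarrow> a * b \<noteq> 0" by (rule no_zero_div)
  show "a div 0 = 0" by (simp add: divide_two_adic_int_def)
  assume b: "b \<noteq> 0"
  have "z = a" if "a * b = b * z" for z
  proof -
    have "b * (a - z) = 0" using that by (simp add: algebra_simps)
    thus ?thesis using no_zero_div[OF b, of "a - z"] by auto
  qed
  hence "(THE z. a * b = b * z) = a"
    by (intro the_equality) (auto simp: mult.commute)
  thus "a * b div b = a"
    using b by (simp add: divide_two_adic_int_def)
qed

instance two_adic_int :: algebraic_semidom ..

instance two_adic_int :: ring_char_0
proof
  show "inj (of_nat :: nat \<Rightarrow> two_adic_int)"
  proof (rule injI)
    fix a b :: nat
    assume "of_nat a = (of_nat b :: two_adic_int)"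
    hence "int a mod 2 ^ (a + b) = int b mod 2 ^ (a + b)"
      by (metis residue_of_nat)
    moreover have "a < 2 ^ (a + b)" "b < 2 ^ (a + b)"
      using less_exp[of "a + b"] by linarith+
    hence "int a < 2 ^ (a + b)" "int b < 2 ^ (a + b)"
      by (simp_all flip: of_nat_less_iff)
    ultimately show "a = b" by simp
  qed
qed

lemma unit_three: "(3 :: two_adic_int) dvd 1"
proof -
  define c :: "nat \<Rightarrow> int" where "c n = (\<Sum>i<n. (- 2) ^ i)" for n
  have c3: "3 * c n = 1 - (- 2) ^ n" for n
    unfolding c_def by (induction n) (simp_all add: algebra_simps)
  have c_mod: "c n mod 2 ^ m = c m mod 2 ^ m" if "m \<le> n" for m n
  proof -
    have "c n = c m + (\<Sum>i\<in>{m..<n}. (- 2) ^ i)"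
      using that sum.atLeastLessThan_concat[of 0 m n "\<lambda>i. (- 2 :: int) ^ i"]
      by (simp add: c_def lessThan_atLeast0)
    moreover have "2 ^ m dvd (\<Sum>i\<in>{m..<n}. (- 2 :: int) ^ i)"
      by (intro dvd_sum) (metis atLeastLessThan_iff dvd_minus_iff dvd_refl dvd_power_le)
    ultimately show ?thesis
      by (auto elim!: dvdE)
  qed
  define v where "v = Abs_two_adic_int (\<lambda>n. c n mod 2 ^ n)"
  have v: "residue v n = c n mod 2 ^ n" for n
    unfolding v_def by (subst Abs_two_adic_int_inverse) (auto simp: mod_mod_two_power intro: c_mod)
  have "3 * v = 1"
  proof (rule two_adic_int_eqI)
    fix n
    have "residue (3 * v) n = (3 * c n) mod 2 ^ n"
      by (simp add: residue_simps residue_numeral v mod_simps)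
    also have "\<dots> = (1 - (- 2) ^ n) mod 2 ^ n"
      by (simp only: c3)
    also have "\<dots> = 1 mod 2 ^ n"
      by (subst mod_eq_dvd_iff) (simp add: power_minus[of "2 :: int" n])
    finally show "residue (3 * v) n = residue 1 n"
      by (simp add: residue_simps)
  qed
  thus ?thesis by (metis dvdI)
qed

lemma unit_three_power: "(3 ^ i :: two_adic_int) dvd 1"
  using unit_three by (metis dvd_power_same power_one)

lemma divide_three_power_mult: "x / 3 ^ i * (3 ^ i :: two_adic_int) = x"
proof -
  have "3 ^ i dvd x" using unit_three_power dvd_trans one_dvd by blast
  thus ?thesis by (auto elim!: dvdE simp: mult.commute[of "3 ^ i"])
qed

section \<open>The 2-adic topology\<close>

text \<open>The exponent is the 2-adic valuation of \<open>x - y\<close>.\<close>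

instantiation two_adic_int :: metric_space
begin

definition dist_two_adic_int :: "two_adic_int \<Rightarrow> two_adic_int \<Rightarrow> real" where
  "dist_two_adic_int x y =
    (if x = y then 0 else (1 / 2) ^ (LEAST n. residue x (Suc n) \<noteq> residue y (Suc n)))"

definition uniformity_two_adic_int :: "(two_adic_int \<times> two_adic_int) filter" where
  "uniformity_two_adic_int = (INF e\<in>{0 <..}. principal {(x, y). dist x y < e})"

definition open_two_adic_int :: "two_adic_int set \<Rightarrow> bool" where
  "open_two_adic_int U \<longleftrightarrow> (\<forall>x\<in>U. eventually (\<lambda>(x', y). x' = x \<longrightarrow> y \<in> U) uniformity)"

lemma dist_two_adic_int_le_iff: "dist x y \<le> (1 / 2) ^ n \<longleftrightarrow> residue x n = residue y n"
  for x y :: two_adic_int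
proof (cases "x = y")
  case True
  thus ?thesis by (simp add: dist_two_adic_int_def)
next
  case False
  define P where "P n \<longleftrightarrow> residue x (Suc n) \<noteq> residue y (Suc n)" for n
  obtain j where "residue x j \<noteq> residue y j" using False two_adic_int_eqI by blast
  hence ex: "P (j - 1)" by (cases j) (auto simp: P_def)
  define k where "k = (LEAST n. P n)"
  have k: "P k"
    unfolding k_def by (rule LeastI[of P, OF ex])
  have below: "\<not> P i" if "i < k" for i
    using that unfolding k_def by (rule not_less_Least)
  have "residue x n = residue y n \<longleftrightarrow> n \<le> k"
  proof
    assume "residue x n = residue y n"
    thus "n \<le> k" using k residue_eq_mono[of x n y "Suc k"] unfolding P_def by linarith
  next
    assume "n \<le> k"
    thus "residue x n = residue y n"
      using below[of "n - 1"] by (cases n) (auto simp: P_def)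
  qed
  moreover have "dist x y = (1 / 2) ^ k"
    using False by (simp add: dist_two_adic_int_def k_def P_def)
  ultimately show ?thesis by simp
qed

instance
proof
  show "uniformity = (INF e\<in>{0 <..}. principal {(x, y :: two_adic_int). dist x y < e})"
    by (rule uniformity_two_adic_int_def)
  show "open U \<longleftrightarrow> (\<forall>x\<in>U. eventually (\<lambda>(x', y). x' = x \<longrightarrow> y \<in> U) uniformity)"
    for U :: "two_adic_int set"
    by (rule open_two_adic_int_def)
  fix x y z :: two_adic_int
  show "dist x y = 0 \<longleftrightarrow> x = y" by (simp add: dist_two_adic_int_def)
  have cases: "dist u v = 0 \<or> (\<exists>n. dist u v = (1 / 2) ^ n)" for u v :: two_adic_int
    by (auto simp: dist_two_adic_int_def)
  have nonneg: "dist u v \<ge> 0" for u v :: two_adic_int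
    by (simp add: dist_two_adic_int_def)
  have ultra: "dist x y \<le> (1 / 2) ^ n" if "dist x z \<le> (1 / 2) ^ n" "dist y z \<le> (1 / 2) ^ n" for n
    using that by (simp add: dist_two_adic_int_le_iff)
  have "dist x y \<le> max (dist x z) (dist y z)"
  proof (cases "dist x z = 0 \<and> dist y z = 0")
    case True
    hence "x = y" by (simp add: dist_two_adic_int_def split: if_splits)
    thus ?thesis using nonneg by (simp add: dist_two_adic_int_def)
  next
    case False
    hence "max (dist x z) (dist y z) > 0"
      using nonneg[of x z] nonneg[of y z] by linarith
    then obtain n where "max (dist x z) (dist y z) = (1 / 2) ^ n"
      using cases[of x z] cases[of y z] unfolding max_def by (metis less_irrefl)
    thus ?thesis using ultra[of n] by (metis max.cobounded1 max.cobounded2)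
  qed
  thus "dist x y \<le> dist x z + dist y z"
    using nonneg[of x z] nonneg[of y z] by linarith
qed

end

lemma tendsto_two_adic_int_iff:
  fixes f :: "'a \<Rightarrow> two_adic_int"
  shows "(f \<longlongrightarrow> l) F \<longleftrightarrow> (\<forall>n. \<forall>\<^sub>F i in F. residue (f i) n = residue l n)"
proof (intro iffI allI)
  fix n
  assume "(f \<longlongrightarrow> l) F"
  hence "\<forall>\<^sub>F i in F. dist (f i) l < (1 / 2) ^ n"
    by (rule tendstoD) simp
  thus "\<forall>\<^sub>F i in F. residue (f i) n = residue l n"
    by eventually_elim (simp flip: dist_two_adic_int_le_iff)
next
  assume *: "\<forall>n. \<forall>\<^sub>F i in F. residue (f i) n = residue l n"
  show "(f \<longlongrightarrow> l) F"
  proof (rule tendstoI)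
    fix e :: real
    assume "e > 0"
    then obtain n where n: "(1 / 2) ^ n < e"
      using real_arch_pow_inv[of e "1 / 2"] by auto
    show "\<forall>\<^sub>F i in F. dist (f i) l < e"
      using *[rule_format, of n]
      by eventually_elim (use n in \<open>simp flip: dist_two_adic_int_le_iff\<close>)
  qed
qed

lemma has_sum_two_adic_int_iff:
  fixes f :: "'a \<Rightarrow> two_adic_int"
  shows "(f has_sum s) A \<longleftrightarrow>
    (\<forall>n. \<forall>\<^sub>F F in finite_subsets_at_top A. residue (sum f F) n = residue s n)"
  by (simp add: has_sum_def tendsto_two_adic_int_iff)

lemma has_sum_two_adic_intI:
  fixes f :: "'a \<Rightarrow> two_adic_int"
  assumes fin: "\<And>n. finite {i \<in> A. residue (f i) n \<noteq> 0}"
    and s: "\<And>n. residue s n = (\<Sum>i | i \<in> A \<and> residue (f i) n \<noteq> 0. residue (f i) n) mod 2 ^ n"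
  shows "(f has_sum s) A"
  unfolding has_sum_two_adic_int_iff
proof
  fix n
  have "residue (sum f F) n = residue s n"
    if "finite F" "{i \<in> A. residue (f i) n \<noteq> 0} \<subseteq> F" "F \<subseteq> A" for F
    unfolding residue_sum s using that
    by (intro arg_cong[where f = "\<lambda>t. t mod 2 ^ n"] sum.mono_neutral_right) auto
  thus "\<forall>\<^sub>F F in finite_subsets_at_top A. residue (sum f F) n = residue s n"
    unfolding eventually_finite_subsets_at_top
    by (intro exI[of _ "{i \<in> A. residue (f i) n \<noteq> 0}"]) (use fin[of n] in auto)
qed

lemma summable_on_two_adic_int:
  fixes f :: "'a \<Rightarrow> two_adic_int"
  assumes fin: "\<And>n. finite {i \<in> A. residue (f i) n \<noteq> 0}"
  shows "f summable_on A"
proof -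
  define t where "t n = (\<Sum>i | i \<in> A \<and> residue (f i) n \<noteq> 0. residue (f i) n)" for n
  have t_mod: "t n mod 2 ^ m = t m mod 2 ^ m" if mn: "m \<le> n" for m n
  proof -
    have "t n mod 2 ^ m = (\<Sum>i | i \<in> A \<and> residue (f i) n \<noteq> 0. residue (f i) n mod 2 ^ m) mod 2 ^ m"
      unfolding t_def by (simp add: mod_sum_eq)
    also have "\<dots> = (\<Sum>i | i \<in> A \<and> residue (f i) n \<noteq> 0. residue (f i) m) mod 2 ^ m"
      by (simp add: residue_mod mn)
    also have "(\<Sum>i | i \<in> A \<and> residue (f i) n \<noteq> 0. residue (f i) m) = t m"
      unfolding t_def using fin[of n] mn
      by (intro sum.mono_neutral_right) (auto simp flip: residue_mod[OF mn])
    finally show ?thesis .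
  qed
  have "residue (Abs_two_adic_int (\<lambda>n. t n mod 2 ^ n)) n = t n mod 2 ^ n" for n
    by (subst Abs_two_adic_int_inverse) (auto simp: mod_mod_two_power intro: t_mod)
  hence "(f has_sum Abs_two_adic_int (\<lambda>n. t n mod 2 ^ n)) A"
    by (intro has_sum_two_adic_intI fin) (simp add: t_def)
  thus ?thesis by (auto simp: summable_on_def)
qed

section \<open>Binary expansions and the map \<open>\<Phi>\<close>\<close>

definition exponents :: "two_adic_int \<Rightarrow> nat set" where
  "exponents x = {n. bit (residue x (Suc n)) n}"

text \<open>The exponents in increasing order are \<open>enumerate (exponents x) i\<close> for
  \<open>i\<close> in \<open>exponent_indices x\<close>; the latter is all of \<^typ>\<open>nat\<close> or an initial segment.\<close>

definition exponent_indices :: "two_adic_int \<Rightarrow> nat set" where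
  "exponent_indices x = {i. infinite (exponents x) \<or> i < card (exponents x)}"

definition Phi :: "two_adic_int \<Rightarrow> two_adic_int" where
  "Phi x = - (\<Sum>\<^sub>\<infinity>i\<in>exponent_indices x. 2 ^ enumerate (exponents x) i / 3 ^ i)"

definition alpha :: "nat \<Rightarrow> nat" where
  "alpha a = card {i. bit a i}"

lemma strict_mono_on_enumerate_exponents:
  "strict_mono_on (exponent_indices x) (enumerate (exponents x))"
  by (rule strict_mono_onI)
     (auto simp: exponent_indices_def intro: enumerate_mono finite_enumerate_mono)

lemma bij_betw_enumerate_exponents:
  "bij_betw (enumerate (exponents x)) (exponent_indices x) (exponents x)"
proof (cases "finite (exponents x)")
  case True
  hence "exponent_indices x = {..<card (exponents x)}"
    by (auto simp: exponent_indices_def)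
  thus ?thesis using finite_bij_enumerate[OF True] by simp
next
  case False
  thus ?thesis using bij_enumerate by (simp add: exponent_indices_def)
qed

lemma bit_residue_iff: "bit (residue x n) i \<longleftrightarrow> i < n \<and> i \<in> exponents x"
proof (cases "i < n")
  case True
  hence "residue x (Suc i) = take_bit (Suc i) (residue x n)"
    by (simp add: take_bit_eq_mod residue_mod del: power_Suc)
  thus ?thesis using True by (simp add: exponents_def bit_take_bit_iff)
next
  case False
  have "residue x n = take_bit n (residue x n)"
    by (simp add: take_bit_eq_mod)
  thus ?thesis using False by (metis bit_take_bit_iff)
qed

lemma has_sum_exponents: "((\<lambda>n. 2 ^ n) has_sum x) (exponents x)"
proof (rule has_sum_two_adic_intI)
  fix n
  have *: "residue (2 ^ i) n = (if i < n then 2 ^ i else 0)" for i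
    by (auto simp: residue_two_power le_imp_power_dvd)
  have eq: "{i \<in> exponents x. residue (2 ^ i) n \<noteq> 0} = {i. i < n \<and> i \<in> exponents x}"
    by (auto simp: *)
  show "finite {i \<in> exponents x. residue (2 ^ i) n \<noteq> 0}"
    by (simp add: eq)
  have "residue x n = take_bit n (residue x n)"
    by (simp add: take_bit_eq_mod)
  also have "\<dots> = (\<Sum>i = 0..<n. push_bit i (of_bool (bit (residue x n) i)))"
    by (rule take_bit_sum)
  also have "\<dots> = (\<Sum>i | i < n \<and> i \<in> exponents x. 2 ^ i)"
    by (rule sum.mono_neutral_cong_right) (auto simp: bit_residue_iff push_bit_eq_mult)
  finally have "residue x n = (\<Sum>i | i < n \<and> i \<in> exponents x. residue (2 ^ i) n)"
    by (simp add: * cong: conj_cong)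
  thus "residue x n = (\<Sum>i | i \<in> exponents x \<and> residue (2 ^ i) n \<noteq> 0. residue (2 ^ i) n) mod 2 ^ n"
    unfolding eq by (metis residue_mod_self)
qed

lemma residue_has_sum_two_powers:
  assumes "((\<lambda>n. 2 ^ n :: two_adic_int) has_sum x) S"
  shows "residue x n = (\<Sum>i | i \<in> S \<and> i < n. 2 ^ i) mod 2 ^ n"
proof -
  have "\<forall>\<^sub>F F in finite_subsets_at_top S. residue (\<Sum>i\<in>F. 2 ^ i) n = residue x n"
    using assms by (simp add: has_sum_two_adic_int_iff)
  then obtain X where X: "finite X" "X \<subseteq> S"
    and eq: "\<forall>F. finite F \<and> X \<subseteq> F \<and> F \<subseteq> S \<longrightarrow> residue (\<Sum>i\<in>F. 2 ^ i) n = residue x n"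
    unfolding eventually_finite_subsets_at_top by (elim exE conjE) rule
  define F where "F = X \<union> {i \<in> S. i < n}"
  have F: "finite F" "F \<subseteq> S" using X by (auto simp: F_def)
  have "residue x n = (\<Sum>i\<in>F. 2 ^ i mod 2 ^ n) mod 2 ^ n"
    using eq[rule_format, of F] F by (simp add: F_def residue_sum residue_two_power)
  also have "(\<Sum>i\<in>F. 2 ^ i mod 2 ^ n) = (\<Sum>i | i \<in> S \<and> i < n. 2 ^ i mod 2 ^ n :: int)"
    using F by (intro sum.mono_neutral_right)
      (auto simp: F_def, metis le_imp_power_dvd dvd_imp_mod_0 not_less)
  finally show ?thesis by (simp add: mod_sum_eq)
qed

lemma exponents_unique:
  assumes S: "((\<lambda>n. 2 ^ n :: two_adic_int) has_sum x) S"
  shows "S = exponents x"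
proof -
  have "n \<in> S \<longleftrightarrow> n \<in> exponents x" for n
  proof (induction n rule: less_induct)
    case (less n)
    define t where "t = (\<Sum>i | i \<in> S \<and> i < n. 2 ^ i :: int)"
    have split: "(\<Sum>i | i \<in> A \<and> i < Suc n. 2 ^ i) = t + (if n \<in> A then 2 ^ n else 0)"
      if "\<And>i. i < n \<Longrightarrow> i \<in> A \<longleftrightarrow> i \<in> S" for A
    proof -
      have "{i. i \<in> A \<and> i < Suc n} =
          (if n \<in> A then insert n {i. i \<in> S \<and> i < n} else {i. i \<in> S \<and> i < n})"
        using that by (auto simp: less_Suc_eq)
      thus ?thesis by (simp add: t_def)
    qed
    have "(t + (if n \<in> S then 2 ^ n else 0)) mod 2 ^ Suc n =
        (t + (if n \<in> exponents x then 2 ^ n else 0)) mod 2 ^ Suc n"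
      using residue_has_sum_two_powers[OF S, of "Suc n"]
        residue_has_sum_two_powers[OF has_sum_exponents, of x "Suc n"]
        split[of S] split[of "exponents x"] less.IH by simp
    thus ?case
      by (auto simp: mod_eq_dvd_iff zdvd_not_zless split: if_splits)
  qed
  thus ?thesis by blast
qed

lemma has_sum_enumerate_exponents:
  "((\<lambda>i. 2 ^ enumerate (exponents x) i) has_sum x) (exponent_indices x)"
  using has_sum_exponents
  by (simp add: has_sum_reindex_bij_betw[OF bij_betw_enumerate_exponents, of "\<lambda>n. 2 ^ n"])

lemma residue_two_power_mult_eq_0: "n \<le> k \<Longrightarrow> residue (2 ^ k * x) n = 0"
  by (simp add: residue_simps residue_two_power mod_simps le_imp_power_dvd)

lemma summable_on_Phi:
  "(\<lambda>i. 2 ^ enumerate (exponents x) i / 3 ^ i :: two_adic_int) summable_on exponent_indices x"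
proof (rule summable_on_two_adic_int)
  fix n
  have "2 ^ k * (1 / 3 ^ i) = (2 ^ k / 3 ^ i :: two_adic_int)" for k i
    using div_mult_swap[OF unit_three_power[of i], of "2 ^ k"] by simp
  hence zero: "residue (2 ^ k / 3 ^ i) n = 0" if "n \<le> k" for k i
    using residue_two_power_mult_eq_0[OF that, of "1 / 3 ^ i"] by (simp only:)
  have "{i \<in> exponent_indices x. residue (2 ^ enumerate (exponents x) i / 3 ^ i) n \<noteq> 0}
      \<subseteq> {i \<in> exponent_indices x. enumerate (exponents x) i \<in> {..<n}}"
    by (clarsimp, rule ccontr) (simp add: zero not_less)
  moreover have "finite \<dots>"
    using finite_vimage_IntI[of "{..<n}" "enumerate (exponents x)" "exponent_indices x"]
      bij_betw_enumerate_exponents[of x]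
    by (auto simp: bij_betw_def vimage_def Int_def conj_commute)
  ultimately show "finite {i \<in> exponent_indices x. residue (2 ^ enumerate (exponents x) i / 3 ^ i) n \<noteq> 0}"
    by (rule finite_subset)
qed

end

theory Submission
  imports Defs
begin

text \<open>Indexing the series by the exponents themselves gives
  \<open>\<Phi> x = - (\<Sum>n\<in>S. 2 ^ n / 3 ^ r n)\<close>, where \<open>S\<close> is the set of exponents of \<open>x\<close> and \<open>r n\<close> is the
  number of elements of \<open>S\<close> below \<open>n\<close>. If all exponents of \<open>a\<close> lie below \<open>k\<close>, then adjoining to them
  the exponents of \<open>x\<close> shifted by \<open>k\<close> leaves the ranks of the former unchanged and raises the ranks
  of the latter by \<open>\<alpha>(a)\<close>. So a series \<open>\<Sum>n. b ^ n * c ^ r n\<close> over the union splits into the series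
  for \<open>a\<close> and \<open>b ^ k * c ^ \<alpha>(a)\<close> times the series for \<open>x\<close>. With \<open>b = 2\<close>, the case \<open>c = 1\<close> identifies
  the union as the set of exponents of \<open>a + 2 ^ k x\<close>, and the case \<open>c = 1 / 3\<close> is then the claim.\<close>

definition card_below :: "'a::ord set \<Rightarrow> 'a \<Rightarrow> nat" where
  "card_below S x = card {y \<in> S. y < x}"

lemma card_below_enumerate:
  fixes S :: "nat set"
  assumes index: "finite S \<Longrightarrow> i < card S"
  shows "card_below S (enumerate S i) = i"
proof -
  have mono: "enumerate S m < enumerate S n" if "m < n" "finite S \<Longrightarrow> n < card S" for m n
    using that by (cases "finite S") (auto intro: finite_enumerate_mono enumerate_mono)
  have "{y \<in> S. y < enumerate S i} = enumerate S ` {..<i}"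
  proof (intro subset_antisym subsetI)
    fix y
    assume "y \<in> {y \<in> S. y < enumerate S i}"
    hence "y \<in> S" and y_less: "y < enumerate S i" by simp_all
    then obtain j where j_index: "finite S \<Longrightarrow> j < card S" and y_eq: "y = enumerate S j"
      by (metis enumerate_Ex finite_enumerate_Ex)
    have "j < i"
      using mono[of i j, OF _ j_index] y_less y_eq by (cases i j rule: linorder_cases) auto
    thus "y \<in> enumerate S ` {..<i}" by (simp add: y_eq)
  next
    fix y
    assume "y \<in> enumerate S ` {..<i}"
    then obtain j where "j < i" "y = enumerate S j" by blast
    moreover have "enumerate S j \<in> S"
      using \<open>j < i\<close> index by (cases "finite S") (auto intro: finite_enumerate_in_set enumerate_in_set)
    ultimately show "y \<in> {y \<in> S. y < enumerate S i}"
      using mono index by simp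
  qed
  moreover have "inj_on (enumerate S) {..<i}"
    using mono index by (intro strict_mono_on_imp_inj_on strict_mono_onI) force
  ultimately show ?thesis
    by (simp add: card_below_def card_image)
qed

lemma card_below_Un_translate_left:
  fixes A B :: "nat set"
  assumes "n \<le> k"
  shows "card_below (A \<union> (+) k ` B) n = card_below A n"
  unfolding card_below_def using assms by (intro arg_cong[where f = card]) auto

lemma card_below_Un_translate_right:
  fixes A B :: "nat set"
  assumes A_below: "A \<subseteq> {..<k}"
  shows "card_below (A \<union> (+) k ` B) (k + n) = card A + card_below B n"
proof -
  have "{j \<in> A \<union> (+) k ` B. j < k + n} = A \<union> (+) k ` {j \<in> B. j < n}"
    using A_below by auto
  moreover have "A \<inter> (+) k ` {j \<in> B. j < n} = {}" and "finite A"
    using A_below by (auto intro: finite_subset)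
  ultimately show ?thesis
    by (simp add: card_below_def card_Un_disjoint card_image)
qed

lemma has_sum_card_below_Un_translate:
  fixes b c :: "'a::{comm_semiring_1, topological_comm_monoid_add, topological_semigroup_mult}"
  assumes A_below: "A \<subseteq> {..<k}"
    and sum_A: "((\<lambda>n. b ^ n * c ^ card_below A n) has_sum s) A"
    and sum_B: "((\<lambda>n. b ^ n * c ^ card_below B n) has_sum t) B"
  shows "((\<lambda>n. b ^ n * c ^ card_below (A \<union> (+) k ` B) n) has_sum
    s + b ^ k * c ^ card A * t) (A \<union> (+) k ` B)"
    (is "(?f has_sum _) _")
proof (rule has_sum_Un_disjoint)
  have "card_below (A \<union> (+) k ` B) n = card_below A n" if "n \<in> A" for n
    using A_below that by (intro card_below_Un_translate_left) auto
  thus "(?f has_sum s) A"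
    by (intro has_sum_cong[THEN iffD1, OF _ sum_A]) simp
  have "?f (k + n) = b ^ k * c ^ card A * (b ^ n * c ^ card_below B n)" for n
    unfolding card_below_Un_translate_right[OF A_below] by (simp add: power_add mult_ac)
  thus "(?f has_sum b ^ k * c ^ card A * t) ((+) k ` B)"
    using has_sum_cmult_right[OF sum_B, of "b ^ k * c ^ card A"]
    by (simp add: has_sum_reindex o_def)
  show "A \<inter> (+) k ` B = {}"
    using A_below by auto
qed

lemma tendsto_nhds_prod_two_adic_int:
  fixes f :: "two_adic_int \<Rightarrow> two_adic_int \<Rightarrow> two_adic_int"
  assumes "\<And>x y n. residue x n = residue a n \<Longrightarrow> residue y n = residue b n \<Longrightarrow>
    residue (f x y) n = residue (f a b) n"
  shows "((\<lambda>p. f (fst p) (snd p)) \<longlongrightarrow> f a b) (nhds a \<times>\<^sub>F nhds b)"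
  unfolding tendsto_two_adic_int_iff
proof
  fix n
  have "\<forall>\<^sub>F x in nhds c. residue x n = residue c n" for c
    using filterlim_ident[of "nhds c"] by (simp add: tendsto_two_adic_int_iff)
  from eventually_prodI[OF this this]
  show "\<forall>\<^sub>F p in nhds a \<times>\<^sub>F nhds b. residue (f (fst p) (snd p)) n = residue (f a b) n"
    by (rule eventually_mono) (blast intro: assms)
qed

instance two_adic_int :: topological_comm_monoid_add
  by standard (rule tendsto_nhds_prod_two_adic_int, simp add: residue_simps)

instance two_adic_int :: topological_semigroup_mult
  by standard (rule tendsto_nhds_prod_two_adic_int, simp add: residue_simps)

lemma unit_div_power_eq:
  fixes a u :: "'a::algebraic_semidom"
  assumes "is_unit u"
  shows "a div u ^ n = a * (1 div u) ^ n"
proof -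
  have "a div u ^ n = a * (1 div u ^ n)"
    using assms unit_div_mult_swap[of "u ^ n" a 1] by (simp add: is_unit_power_iff)
  thus ?thesis
    using div_power[OF assms] by simp
qed

lemma exponents_of_nat: "exponents (of_nat a) = {i. bit a i}"
  by (auto simp: exponents_def residue_of_nat bit_take_bit_iff bit_of_nat_iff
      simp flip: take_bit_eq_mod simp del: power_Suc)

lemma exponents_of_nat_subset:
  assumes "a < 2 ^ k"
  shows "exponents (of_nat a) \<subseteq> {..<k}"
  using bit_take_bit_iff[of k a] assms by (auto simp: exponents_of_nat take_bit_nat_eq_self)

lemma exponents_add_two_power_mult:
  assumes "exponents y \<subseteq> {..<k}"
  shows "exponents (y + 2 ^ k * x) = exponents y \<union> (+) k ` exponents x"
proof (rule exponents_unique[symmetric])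
  show "((\<lambda>n. 2 ^ n) has_sum y + 2 ^ k * x) (exponents y \<union> (+) k ` exponents x)"
    using has_sum_card_below_Un_translate[OF assms, of 2 1 y "exponents x" x]
    by (simp add: has_sum_exponents)
qed

lemma has_sum_Phi:
  "((\<lambda>n. 2 ^ n * (1 / 3) ^ card_below (exponents x) n) has_sum - Phi x) (exponents x)"
proof (subst has_sum_reindex_bij_betw[OF bij_betw_enumerate_exponents, symmetric])
  let ?e = "enumerate (exponents x)"
  have "2 ^ ?e i / 3 ^ i = (2 ^ ?e i * (1 / 3) ^ card_below (exponents x) (?e i) :: two_adic_int)"
    if "i \<in> exponent_indices x" for i
    using that by (simp add: exponent_indices_def card_below_enumerate unit_div_power_eq[OF unit_three])
  moreover have "((\<lambda>i. 2 ^ ?e i / 3 ^ i) has_sum - Phi x) (exponent_indices x)"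
    using summable_on_Phi[of x] by (simp add: Phi_def)
  ultimately show "((\<lambda>i. 2 ^ ?e i * (1 / 3) ^ card_below (exponents x) (?e i)) has_sum - Phi x)
      (exponent_indices x)"
    by (rule has_sum_cong[THEN iffD1])
qed

lemma Phi_add_two_power_mult:
  assumes y_below: "exponents y \<subseteq> {..<k}"
  shows "Phi (y + 2 ^ k * x) = Phi y + Phi x / 3 ^ card (exponents y) * 2 ^ k"
proof -
  have "- Phi (y + 2 ^ k * x) = - Phi y + 2 ^ k * (1 / 3) ^ card (exponents y) * - Phi x"
    using has_sum_Phi[of "y + 2 ^ k * x"]
      has_sum_card_below_Un_translate[OF y_below has_sum_Phi has_sum_Phi, of x]
    unfolding exponents_add_two_power_mult[OF y_below] by (rule has_sum_unique)
  also have "\<dots> = - (Phi y + Phi x / 3 ^ card (exponents y) * 2 ^ k)"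
    by (simp add: unit_div_power_eq[OF unit_three] mult_ac)
  finally show ?thesis by (simp only: neg_equal_iff_equal)
qed

theorem theorem11:
  fixes x :: two_adic_int and k a m :: nat
  assumes "a < 2 ^ k" and "m = alpha a"
  shows "Phi (of_nat a + 2 ^ k * x) = Phi (of_nat a) + Phi x / 3 ^ m * 2 ^ k"
proof -
  have "card (exponents (of_nat a)) = m"
    by (simp add: assms(2) alpha_def exponents_of_nat)
  thus ?thesis
    using Phi_add_two_power_mult[OF exponents_of_nat_subset[OF assms(1)], of x] by simp
qed

end
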